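(* For every proof $\mathcal{T}$ in $\mathcal{H}\omega$ there exists a proof $\mathcal{T}'$ in $\mathcal{H}\omega$ of the same conclusion whose endpiece (if it has one) is in normal form.
   Context: Untyped $\lambda$-calculus; $[N/x]U$ is capture-avoiding substitution; $\mathbf{\Omega}\equiv(\lambda x.xx)(\lambda x.xx)$; a closed term is unsolvable if no application of it to closed terms $\beta$-converts to $\lambda x.x$. $\mathcal{H}\omega$ proves equations $M=_\omega N$ between closed terms using: Identity axioms $M=_\omega M$; weak $\beta\mathbf{\Omega}$-conversion axioms $(\lambda x.U)N =_\omega [N/x]U$ and $[N/x]U=_\omega(\lambda x.U)N$ (for closed $(\lambda x.U)N$), $M=_\omega\mathbf{\Omega}$ and $\mathbf{\Omega}=_\omega M$ (for closed unsolvable $M$); the Leibniz rule (from $[M/z]X=_\omega[M/z]Y$ and $M=_\omega N$, where $X,Y$ have no free variable other than possibly $z$, infer $[N/z]X=_\omega[N/z]Y$); and the $\omega$-rule (from the premises $PM=_\omega QM$ for all closed $M$ infer $P=_\omega Q$). A proof is a well-founded, possibly infinitely branching, tree of such inferences. If a proof does not end with the $\omega$-rule, its endpiece is the set of nodes whose path to the root passes through no premise of an $\omega$-rule inference; it is a finite tree of Leibniz inferences whose leaves are axioms or conclusions of $\omega$-rule inferences. Weak $\beta\mathbf{\Omega}$-conversion $\sim_{w\beta\Omega}$ is the least congruence on terms containing the weak conversion axioms above. An endpiece is in normal form if it establishes $M=_\omega N$ as a chain $M\sim_{w\beta\Omega} M_1P_1$, $P_1=_\omega Q_1$, $M_1Q_1\sim_{w\beta\Omega}M_2P_2$,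 $\dots$, $P_t=_\omega Q_t$, $M_tQ_t\sim_{w\beta\Omega}N$ (each step realized by a Leibniz inference: transitivity steps and substitutions of $Q_i$ for $P_i$ in the applicative context $M_i[\ ]$), where each $P_i=_\omega Q_i$ is the direct conclusion of an $\omega$-rule inference; degenerate cases ($t=0$) are an Identity axiom alone, or $M=_\omega N$ obtained from $M=_\omega M$ and $M\sim_{w\beta\Omega}N$. *)

theory Defs
  imports Main
begin

text \<open>Untyped lambda-terms up to alpha-equivalence, with de Bruijn indices.\<close>

datatype trm = Var nat | App trm trm | Lam trm

primrec lift :: "trm \<Rightarrow> nat \<Rightarrow> trm" where
  "lift (Var i) k = (if i < k then Var i else Var (Suc i))"
| "lift (App s t) k = App (lift s k) (lift t k)"
| "lift (Lam t) k = Lam (lift t (Suc k))"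

text \<open>\<open>t[s/k]\<close> also lowers the indices above \<open>k\<close>, so that \<open>U[N/0]\<close> is the contractum of
  \<open>App (Lam U) N\<close>.\<close>

primrec sbst :: "trm \<Rightarrow> trm \<Rightarrow> nat \<Rightarrow> trm" ("_[_'/_]" [300, 0, 0] 300) where
  "(Var i)[s/k] = (if k < i then Var (i - 1) else if i = k then s else Var i)"
| "(App t u)[s/k] = App (t[s/k]) (u[s/k])"
| "(Lam t)[s/k] = Lam (t[lift s 0/Suc k])"

text \<open>All free indices are below \<open>n\<close>. Thus \<open>fv_below 1 X\<close> says that \<open>X\<close> has no free variable
  other than possibly \<open>z\<close>, represented by index \<open>0\<close>.\<close>

primrec fv_below :: "nat \<Rightarrow> trm \<Rightarrow> bool" where
  "fv_below n (Var i) \<longleftrightarrow> i < n"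
| "fv_below n (App s t) \<longleftrightarrow> fv_below n s \<and> fv_below n t"
| "fv_below n (Lam t) \<longleftrightarrow> fv_below (Suc n) t"

abbreviation closed_trm :: "trm \<Rightarrow> bool" where
  "closed_trm M \<equiv> fv_below 0 M"

definition Omega :: trm where
  "Omega = App (Lam (App (Var 0) (Var 0))) (Lam (App (Var 0) (Var 0)))"

inductive beta_conv :: "trm \<Rightarrow> trm \<Rightarrow> bool" (infix "=\<^sub>\<beta>" 50) where
  beta: "App (Lam U) N =\<^sub>\<beta> U[N/0]"
| refl: "M =\<^sub>\<beta> M"
| sym: "M =\<^sub>\<beta> N \<Longrightarrow> N =\<^sub>\<beta> M"
| trans: "M =\<^sub>\<beta> N \<Longrightarrow> N =\<^sub>\<beta> P \<Longrightarrow> M =\<^sub>\<beta> P"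
| app: "M =\<^sub>\<beta> M' \<Longrightarrow> N =\<^sub>\<beta> N' \<Longrightarrow> App M N =\<^sub>\<beta> App M' N'"
| lam: "M =\<^sub>\<beta> N \<Longrightarrow> Lam M =\<^sub>\<beta> Lam N"

definition unsolvable :: "trm \<Rightarrow> bool" where
  "unsolvable M \<longleftrightarrow> closed_trm M \<and>
     \<not> (\<exists>Ns. (\<forall>N \<in> set Ns. closed_trm N) \<and> foldl App M Ns =\<^sub>\<beta> Lam (Var 0))"

inductive weak_axiom :: "trm \<Rightarrow> trm \<Rightarrow> bool" where
  "closed_trm (App (Lam U) N) \<Longrightarrow> weak_axiom (App (Lam U) N) (U[N/0])"
| "closed_trm (App (Lam U) N) \<Longrightarrow> weak_axiom (U[N/0]) (App (Lam U) N)"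
| "unsolvable M \<Longrightarrow> weak_axiom M Omega"
| "unsolvable M \<Longrightarrow> weak_axiom Omega M"

inductive weak_conv :: "trm \<Rightarrow> trm \<Rightarrow> bool" (infix "\<sim>\<^sub>w" 50) where
  ax: "weak_axiom M N \<Longrightarrow> M \<sim>\<^sub>w N"
| refl: "M \<sim>\<^sub>w M"
| sym: "M \<sim>\<^sub>w N \<Longrightarrow> N \<sim>\<^sub>w M"
| trans: "M \<sim>\<^sub>w N \<Longrightarrow> N \<sim>\<^sub>w P \<Longrightarrow> M \<sim>\<^sub>w P"
| app: "M \<sim>\<^sub>w M' \<Longrightarrow> N \<sim>\<^sub>w N' \<Longrightarrow> App M N \<sim>\<^sub>w App M' N'"
| lam: "M \<sim>\<^sub>w N \<Longrightarrow> Lam M \<sim>\<^sub>w Lam N"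

text \<open>Inference trees, well-founded because they form a datatype. \<open>Leibniz X Y M N L R\<close> has
  premises \<open>L\<close> and \<open>R\<close>. The premises of \<open>Omega_Rule P Q F\<close> are the \<open>F M\<close> with \<open>M\<close> closed;
  the values of \<open>F\<close> at other terms play no role.\<close>

datatype tree =
    Identity trm
  | Weak_Axiom trm trm
  | Leibniz trm trm trm trm tree tree
  | Omega_Rule trm trm "trm \<Rightarrow> tree"

primrec concl :: "tree \<Rightarrow> trm \<times> trm" where
  "concl (Identity M) = (M, M)"
| "concl (Weak_Axiom M N) = (M, N)"
| "concl (Leibniz X Y M N L R) = (X[N/0], Y[N/0])"
| "concl (Omega_Rule P Q F) = (P, Q)"

primrec is_proof :: "tree \<Rightarrow> bool" where
  "is_proof (Identity M) \<longleftrightarrow> closed_trm M"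
| "is_proof (Weak_Axiom M N) \<longleftrightarrow> weak_axiom M N"
| "is_proof (Leibniz X Y M N L R) \<longleftrightarrow>
     fv_below 1 X \<and> fv_below 1 Y \<and>
     is_proof L \<and> concl L = (X[M/0], Y[M/0]) \<and>
     is_proof R \<and> concl R = (M, N)"
| "is_proof (Omega_Rule P Q F) \<longleftrightarrow>
     closed_trm P \<and> closed_trm Q \<and>
     (\<forall>M. closed_trm M \<longrightarrow> is_proof (F M) \<and> concl (F M) = (App P M, App Q M))"

text \<open>Endpieces: \<open>Omega_Leaf P Q\<close> is a leaf \<open>P = Q\<close> that is the conclusion of an omega-rule
  inference, everything above it being cut off.\<close>

datatype endpiece =
    Identity_Leaf trm
  | Weak_Leaf trm trm
  | Omega_Leaf trm trm
  | Leibniz_Node trm trm trm trm endpiece endpiece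

primrec cut :: "tree \<Rightarrow> endpiece" where
  "cut (Identity M) = Identity_Leaf M"
| "cut (Weak_Axiom M N) = Weak_Leaf M N"
| "cut (Leibniz X Y M N L R) = Leibniz_Node X Y M N (cut L) (cut R)"
| "cut (Omega_Rule P Q F) = Omega_Leaf P Q"

primrec ends_with_omega :: "tree \<Rightarrow> bool" where
  "ends_with_omega (Identity M) \<longleftrightarrow> False"
| "ends_with_omega (Weak_Axiom M N) \<longleftrightarrow> False"
| "ends_with_omega (Leibniz X Y M N L R) \<longleftrightarrow> False"
| "ends_with_omega (Omega_Rule P Q F) \<longleftrightarrow> True"

definition endpiece_of :: "tree \<Rightarrow> endpiece option" where
  "endpiece_of T = (if ends_with_omega T then None else Some (cut T))"

primrec endpiece_concl :: "endpiece \<Rightarrow> trm \<times> trm" where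
  "endpiece_concl (Identity_Leaf M) = (M, M)"
| "endpiece_concl (Weak_Leaf M N) = (M, N)"
| "endpiece_concl (Omega_Leaf P Q) = (P, Q)"
| "endpiece_concl (Leibniz_Node X Y M N L R) = (X[N/0], Y[N/0])"

primrec omega_free :: "endpiece \<Rightarrow> bool" where
  "omega_free (Identity_Leaf M) \<longleftrightarrow> True"
| "omega_free (Weak_Leaf M N) \<longleftrightarrow> True"
| "omega_free (Omega_Leaf P Q) \<longleftrightarrow> False"
| "omega_free (Leibniz_Node X Y M N L R) \<longleftrightarrow> omega_free L \<and> omega_free R"

text \<open>A weak conversion \<open>A \<sim>\<^sub>w B\<close> used as a premise stands for a piece of the tree that derives
  it from axioms by Leibniz inferences.\<close>

definition conversion_piece :: "trm \<Rightarrow> trm \<Rightarrow> endpiece \<Rightarrow> bool" where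
  "conversion_piece A B C \<longleftrightarrow> A \<sim>\<^sub>w B \<and> omega_free C \<and> endpiece_concl C = (A, B)"

text \<open>Transitivity, from \<open>M = A\<close> and \<open>A = B\<close> to \<open>M = B\<close>, is the Leibniz inference with
  \<open>X = M\<close> and \<open>Y = z\<close>. Replacing \<open>P\<close> by \<open>Q\<close> in the applicative context \<open>K[ ]\<close>, from
  \<open>M = K P\<close> and \<open>P = Q\<close> to \<open>M = K Q\<close>, is the Leibniz inference with \<open>X = M\<close> and \<open>Y = K z\<close>.\<close>

definition transitivity :: "trm \<Rightarrow> trm \<Rightarrow> trm \<Rightarrow> endpiece \<Rightarrow> endpiece \<Rightarrow> endpiece" where
  "transitivity M A B L R = Leibniz_Node M (Var 0) A B L R"

definition replacement :: "trm \<Rightarrow> trm \<Rightarrow> trm \<Rightarrow> trm \<Rightarrow> endpiece \<Rightarrow> endpiece \<Rightarrow> endpiece" where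
  "replacement M K P Q L R = Leibniz_Node M (App K (Var 0)) P Q L R"

text \<open>\<open>chain M N E\<close>: the endpiece \<open>E\<close> derives \<open>M = N\<close> from the identity \<open>M = M\<close> by successively
  appending to the right-hand side
  \<open>M \<sim>\<^sub>w M\<^sub>1 P\<^sub>1\<close>, \<open>P\<^sub>1 = Q\<^sub>1\<close>, \<open>M\<^sub>1 Q\<^sub>1 \<sim>\<^sub>w M\<^sub>2 P\<^sub>2\<close>, ..., \<open>P\<^sub>t = Q\<^sub>t\<close>, \<open>M\<^sub>t Q\<^sub>t \<sim>\<^sub>w N\<close>;
  \<open>t\<close> is the number of uses of \<open>step\<close>.\<close>

inductive chain :: "trm \<Rightarrow> trm \<Rightarrow> endpiece \<Rightarrow> bool" for M where
  start: "closed_trm M \<Longrightarrow> conversion_piece M N C \<Longrightarrow>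
    chain M N (transitivity M M N (Identity_Leaf M) C)"
| step: "chain M (App K P) E \<Longrightarrow> closed_trm K \<Longrightarrow> conversion_piece (App K Q) N C \<Longrightarrow>
    chain M N (transitivity M (App K Q) N (replacement M K P Q E (Omega_Leaf P Q)) C)"

inductive normal_form :: "endpiece \<Rightarrow> bool" where
  "normal_form (Identity_Leaf M)"
| "chain M N E \<Longrightarrow> normal_form E"

end

theory Submission
  imports Defs
begin

text \<open>Read as a relation on closed terms, chains contain weak conversion and the conclusions of
  the omega-rule, because \<open>P \<sim>\<^sub>w I P\<close> with \<open>I = \<lambda>x. x\<close>. They are transitive by concatenation,
  symmetric because the omega-rule is symmetric, and closed under every context \<open>X\<close>: a
  replacement inside \<open>X[K P]\<close> becomes applicative by weak beta-expansion, since
  \<open>X[K P] \<sim>\<^sub>w (\<lambda>x. (\<lambda>z. X) (K x)) P\<close>. Hence they are closed under the Leibniz rule. Conversely,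
  the weak conversions in a chain decompose into single replacements of one side of an axiom by
  the other. Axioms are closed terms, so such a replacement never captures variables, even below
  a \<open>\<lambda>\<close>, and is one Leibniz inference.\<close>

subsection \<open>Closed terms and substitution\<close>

lemma fv_below_mono: "fv_below m t \<Longrightarrow> m \<le> n \<Longrightarrow> fv_below n t"
  by (induction t arbitrary: m n) force+

lemma closed_fv_below_Suc [simp]: "closed_trm t \<Longrightarrow> fv_below (Suc n) t"
  by (rule fv_below_mono) auto

lemma sbst_id: "fv_below n t \<Longrightarrow> n \<le> k \<Longrightarrow> t[s/k] = t"
  by (induction t arbitrary: n k s) force+

lemma lift_id: "fv_below n t \<Longrightarrow> n \<le> k \<Longrightarrow> lift t k = t"
  by (induction t arbitrary: n k) force+

lemma sbst_closed [simp]: "closed_trm t \<Longrightarrow> t[s/k] = t"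
  by (rule sbst_id) auto

lemma lift_closed [simp]: "closed_trm t \<Longrightarrow> lift t k = t"
  by (rule lift_id) auto

lemma sbst_lift [simp]: "(lift t k)[s/k] = t"
  by (induction t arbitrary: k s) auto

lemma fv_below_sbst:
  "fv_below (Suc n) t \<Longrightarrow> closed_trm s \<Longrightarrow> k \<le> n \<Longrightarrow> fv_below n (t[s/k])"
  by (induction t arbitrary: n k) (auto intro: fv_below_mono[of 0])

text \<open>Serves to show that a context read off from a closed term has no free variable except
  its hole.\<close>

lemma fv_below_sbstD: "fv_below n (t[s/k]) \<Longrightarrow> k \<le> n \<Longrightarrow> fv_below (Suc n) t"
proof (induction t arbitrary: n k s)
  case (Lam t)
  then show ?case by (metis Suc_le_mono fv_below.simps(3) sbst.simps(3))
qed (auto split: if_splits)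

lemma closed_sbst: "fv_below 1 X \<Longrightarrow> closed_trm M \<Longrightarrow> closed_trm (X[M/0])"
  by (rule fv_below_sbst) auto


subsection \<open>Weak conversion\<close>

lemma closed_Omega: "closed_trm Omega"
  by (simp add: Omega_def)

lemma weak_axiom_sym: "weak_axiom M N \<Longrightarrow> weak_axiom N M"
  by (induction rule: weak_axiom.induct) (auto intro: weak_axiom.intros)

lemma weak_axiom_closed: "weak_axiom M N \<Longrightarrow> closed_trm M \<and> closed_trm N"
  by (induction rule: weak_axiom.induct)
    (auto simp: unsolvable_def closed_Omega intro: fv_below_sbst)

text \<open>Both sides of a weak axiom are closed, so a replacement leaves the free variables of its
  surroundings unchanged; general beta-conversion may erase some.\<close>

lemma weak_conv_fv_below: "M \<sim>\<^sub>w N \<Longrightarrow> fv_below n M \<longleftrightarrow> fv_below n N"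
proof (induction arbitrary: n rule: weak_conv.induct)
  case (ax M N)
  then show ?case using weak_axiom_closed fv_below_mono by blast
qed auto

lemma weak_conv_beta: "closed_trm (App (Lam U) N) \<Longrightarrow> App (Lam U) N \<sim>\<^sub>w U[N/0]"
  by (intro weak_conv.ax weak_axiom.intros)

lemma weak_conv_sbst:
  fixes X :: trm
  assumes "M \<sim>\<^sub>w N" "closed_trm M"
  shows "X[M/k] \<sim>\<^sub>w X[N/k]"
proof -
  have "closed_trm N" using assms weak_conv_fv_below by blast
  with assms show ?thesis
    by (induction X arbitrary: k) (auto intro: weak_conv.refl weak_conv.app weak_conv.lam)
qed

section \<open>Weak conversion as a sequence of single replacements\<close>

inductive weak_step :: "trm \<Rightarrow> trm \<Rightarrow> bool" where
  ax: "weak_axiom M N \<Longrightarrow> weak_step M N"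
| appL: "weak_step M M' \<Longrightarrow> weak_step (App M N) (App M' N)"
| appR: "weak_step N N' \<Longrightarrow> weak_step (App M N) (App M N')"
| lam: "weak_step M N \<Longrightarrow> weak_step (Lam M) (Lam N)"

lemma weak_step_sym: "weak_step M N \<Longrightarrow> weak_step N M"
  by (induction rule: weak_step.induct) (auto intro: weak_step.intros weak_axiom_sym)

text \<open>The hole index \<open>k\<close> is arbitrary because it grows by one under each
  \<open>Lam\<close>. Lifting the untouched side of an application shields it from the
  substitution.\<close>

lemma weak_step_sbst:
  "weak_step M N \<Longrightarrow> \<exists>X A B. weak_axiom A B \<and> M = X[A/k] \<and> N = X[B/k]"
proof (induction arbitrary: k rule: weak_step.induct)
  case (ax M N)
  then show ?case by (intro exI[of _ "Var k"] exI[of _ M] exI[of _ N]) auto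
next
  case (appL M M' N)
  then obtain X A B :: trm where "weak_axiom A B" "M = X[A/k]" "M' = X[B/k]" by blast
  then show ?case by (intro exI[of _ "App X (lift N k)"] exI[of _ A] exI[of _ B]) auto
next
  case (appR N N' M)
  then obtain X A B :: trm where "weak_axiom A B" "N = X[A/k]" "N' = X[B/k]" by blast
  then show ?case by (intro exI[of _ "App (lift M k) X"] exI[of _ A] exI[of _ B]) auto
next
  case (lam M N)
  then obtain X A B :: trm where "weak_axiom A B" "M = X[A/Suc k]" "N = X[B/Suc k]" by blast
  then show ?case
    using weak_axiom_closed by (intro exI[of _ "Lam X"] exI[of _ A] exI[of _ B]) auto
qed

lemma weak_conv_imp_steps: "M \<sim>\<^sub>w N \<Longrightarrow> weak_step\<^sup>*\<^sup>* M N"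
proof (induction rule: weak_conv.induct)
  case (sym M N)
  have "symp weak_step" using weak_step_sym by (auto intro: sympI)
  then show ?case using sym.IH by (metis symp_rtranclp sympD)
next
  case (app M M' N N')
  have "weak_step\<^sup>*\<^sup>* (App M N) (App M' N)"
    using app.IH(1) by (induction) (auto intro: weak_step.appL rtranclp.rtrancl_into_rtrancl)
  moreover have "weak_step\<^sup>*\<^sup>* (App M' N) (App M' N')"
    using app.IH(2) by (induction) (auto intro: weak_step.appR rtranclp.rtrancl_into_rtrancl)
  ultimately show ?case by auto
next
  case (lam M N)
  from lam.IH show ?case
    by (induction) (auto intro: weak_step.lam rtranclp.rtrancl_into_rtrancl)
qed (auto intro: weak_step.ax)

lemma weak_steps_proof:
  assumes "weak_step\<^sup>*\<^sup>* A B" "closed_trm A"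
  shows "\<exists>T. is_proof T \<and> omega_free (cut T) \<and> concl T = (A, B) \<and> closed_trm B"
  using assms
proof (induction rule: rtranclp_induct)
  case base
  then show ?case by (intro exI[of _ "Identity A"]) auto
next
  case (step B B')
  then obtain T where T: "is_proof T" "omega_free (cut T)" "concl T = (A, B)" "closed_trm B"
    by blast
  obtain X C D :: trm where X: "weak_axiom C D" "B = X[C/0]" "B' = X[D/0]"
    using weak_step_sbst step.hyps(2) by blast
  have "fv_below 1 X" using fv_below_sbstD T(4) X(2) by fastforce
  moreover have "fv_below 1 A" using step.prems by simp
  ultimately show ?case
    using T X step.prems weak_axiom_closed[OF X(1)]
    \<comment> \<open>The left context \<open>A\<close> is closed, so substitution fixes it, while
      the right side passes from \<open>X[C/0]\<close> to \<open>X[D/0]\<close>.\<close>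
    by (intro exI[of _ "Leibniz A X C D T (Weak_Axiom C D)"]) (auto intro: closed_sbst)
qed

lemma conversion_piece_proof:
  assumes "A \<sim>\<^sub>w B" "closed_trm A"
  obtains T where "is_proof T" "concl T = (A, B)" "conversion_piece A B (cut T)"
proof -
  have concl: "endpiece_concl (cut T) = concl T" for T by (cases T) auto
  show thesis
    using weak_steps_proof[OF weak_conv_imp_steps[OF assms(1)] assms(2)] assms(1) that concl
    unfolding conversion_piece_def by metis
qed


subsection \<open>Chains as a relation on closed terms\<close>

definition omega_eq :: "trm \<Rightarrow> trm \<Rightarrow> bool" where
  "omega_eq P Q \<longleftrightarrow> (\<exists>F. is_proof (Omega_Rule P Q F))"

lemma omega_eq_closed: "omega_eq P Q \<Longrightarrow> closed_trm P \<and> closed_trm Q"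
  by (auto simp: omega_eq_def)

lemma omega_eq_sym:
  assumes "omega_eq P Q"
  shows "omega_eq Q P"
proof -
  obtain F where F: "is_proof (Omega_Rule P Q F)" using assms by (auto simp: omega_eq_def)
  \<comment> \<open>With contexts \<open>z\<close> and the constant \<open>App P M\<close>,
    rewriting by \<open>F M\<close> turns only the left side of the identity on
    \<open>App P M\<close> into \<open>App Q M\<close>.\<close>
  define G where "G M = Leibniz (Var 0) (App P M) (App P M) (App Q M) (Identity (App P M)) (F M)"
    for M
  have "is_proof (Omega_Rule Q P G)"
    using F by (auto simp: G_def)
  then show ?thesis by (auto simp: omega_eq_def)
qed

text \<open>The trees are forgotten, so that chains can be concatenated and reversed without
  rebuilding endpieces.\<close>

inductive chain_eq :: "trm \<Rightarrow> trm \<Rightarrow> bool" for M where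
  conv: "closed_trm M \<Longrightarrow> M \<sim>\<^sub>w N \<Longrightarrow> chain_eq M N"
| step: "chain_eq M (App K P) \<Longrightarrow> closed_trm K \<Longrightarrow> omega_eq P Q \<Longrightarrow> App K Q \<sim>\<^sub>w N \<Longrightarrow> chain_eq M N"

lemma chain_eq_closed: "chain_eq M N \<Longrightarrow> closed_trm M \<and> closed_trm N"
proof (induction rule: chain_eq.induct)
  case (conv N)
  then show ?case using weak_conv_fv_below by blast
next
  case (step K P Q N)
  then show ?case using weak_conv_fv_below[of "App K Q" N] omega_eq_closed by auto
qed

lemma chain_eq_conv_trans: "chain_eq M N \<Longrightarrow> N \<sim>\<^sub>w L \<Longrightarrow> chain_eq M L"
proof (induction rule: chain_eq.induct)
  case (conv N)
  then show ?case by (intro chain_eq.conv weak_conv.trans[of M N L])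
next
  case (step K P Q N)
  then show ?case by (intro chain_eq.step[of M K P Q L] weak_conv.trans[of "App K Q" N L])
qed

lemma chain_eq_trans:
  assumes "chain_eq A M" "chain_eq M N"
  shows "chain_eq A N"
  using assms(2)
proof (induction rule: chain_eq.induct)
  case (conv N)
  then show ?case using assms(1) chain_eq_conv_trans by blast
next
  case (step K P Q N)
  then show ?case by (intro chain_eq.step[of A K P Q N])
qed

text \<open>The last link, reversed by \<open>omega_eq_sym\<close>, leads from \<open>N\<close> to
  \<open>App K P\<close>; the reversal of the earlier links is appended to it.\<close>

lemma chain_eq_sym: "chain_eq M N \<Longrightarrow> chain_eq N M"
proof (induction rule: chain_eq.induct)
  case (conv N)
  then show ?case using weak_conv_fv_below chain_eq.conv weak_conv.sym by metis
next
  case (step K P Q N)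
  then have "closed_trm (App K Q)" using omega_eq_closed by auto
  then have "chain_eq N (App K Q)"
    using step.hyps(4) weak_conv_fv_below chain_eq.conv weak_conv.sym by metis
  then have "chain_eq N (App K P)"
    using step.hyps(2) omega_eq_sym[OF step.hyps(3)] weak_conv.refl by (rule chain_eq.step)
  then show ?case using step.IH chain_eq_trans by blast
qed

lemma omega_eq_imp_chain_eq:
  assumes "omega_eq P Q"
  shows "chain_eq P Q"
proof -
  let ?I = "Lam (Var 0)"
  have I: "App ?I R \<sim>\<^sub>w R" if "closed_trm R" for R
    using weak_conv_beta[of "Var 0" R] that by simp
  have "chain_eq P (App ?I P)"
    using omega_eq_closed[OF assms] by (intro chain_eq.conv weak_conv.sym[OF I]) auto
  then show ?thesis
    using I omega_eq_closed[OF assms] assms by (intro chain_eq.step[of P ?I P Q Q]) auto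
qed

lemma chain_eq_sbst:
  fixes X :: trm
  assumes "chain_eq M N" "fv_below 1 X"
  shows "chain_eq (X[M/0]) (X[N/0])"
  using assms(1)
proof (induction rule: chain_eq.induct)
  case (conv N)
  then show ?case
    using assms(2) by (intro chain_eq.conv closed_sbst weak_conv_sbst)
next
  case (step K P Q N)
  let ?K = "Lam (App (Lam X) (App K (Var 0)))"
  have closed: "closed_trm P" "closed_trm Q" using step.hyps(3) omega_eq_closed by auto
  have K: "closed_trm ?K" using assms(2) step.hyps(2) by (auto intro: fv_below_mono[of 1])
  have expand: "App ?K R \<sim>\<^sub>w X[App K R/0]" if R: "closed_trm R" for R
  proof -
    have X: "closed_trm (Lam X)" using assms(2) by simp
    \<comment> \<open>\<open>Lam X\<close> is kept intact as one closed term, which the substitution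
      fixes; the simplifier must not push it under the binder.\<close>
    have "(App (Lam X) (App K (Var 0)))[R/0] = App (Lam X) (App K R)"
      using sbst_closed[OF X, of R 0] step.hyps(2) by (simp del: sbst.simps(3))
    then have "App ?K R \<sim>\<^sub>w App (Lam X) (App K R)"
      using weak_conv_beta[of "App (Lam X) (App K (Var 0))" R] K R by simp
    moreover have "App (Lam X) (App K R) \<sim>\<^sub>w X[App K R/0]"
      using X step.hyps(2) R by (intro weak_conv_beta) simp
    ultimately show ?thesis by (rule weak_conv.trans)
  qed
  have "chain_eq (X[M/0]) (App ?K P)"
    using step.IH weak_conv.sym[OF expand[OF closed(1)]] by (rule chain_eq_conv_trans)
  moreover have "App ?K Q \<sim>\<^sub>w X[N/0]"
    using step.hyps(2) closed(2)
    by (intro weak_conv.trans[OF expand weak_conv_sbst[OF step.hyps(4)]]) auto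
  ultimately show ?case using K step.hyps(3) by (intro chain_eq.step[of _ ?K P Q "X[N/0]"])
qed

section \<open>From proofs to chains and back to proofs\<close>

lemma proof_imp_chain_eq: "is_proof T \<Longrightarrow> concl T = (M, N) \<Longrightarrow> chain_eq M N"
proof (induction T arbitrary: M N)
  case (Identity A)
  then show ?case by (auto intro: chain_eq.conv weak_conv.refl)
next
  case (Weak_Axiom A B)
  then show ?case using weak_axiom_closed by (auto intro: chain_eq.conv weak_conv.ax)
next
  case (Leibniz X Y A B L R)
  then have AB: "chain_eq A B" and XY: "chain_eq (X[A/0]) (Y[A/0])" by auto
  \<comment> \<open>The Leibniz conclusion is reached through \<open>X[A/0]\<close> and
    \<open>Y[A/0]\<close>, the two sides of the left premise.\<close>
  have "chain_eq (X[B/0]) (X[A/0])" "chain_eq (Y[A/0]) (Y[B/0])"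
    using Leibniz.prems AB by (auto intro: chain_eq_sbst chain_eq_sym)
  then have "chain_eq (X[B/0]) (Y[B/0])" using XY chain_eq_trans by blast
  then show ?case using Leibniz.prems by simp
next
  case (Omega_Rule P Q F)
  then have "omega_eq P Q" unfolding omega_eq_def by blast
  then show ?case using Omega_Rule.prems omega_eq_imp_chain_eq by simp
qed

lemma chain_eq_imp_chain:
  "chain_eq M N \<Longrightarrow> \<exists>T. is_proof T \<and> concl T = (M, N) \<and> chain M N (cut T)"
proof (induction rule: chain_eq.induct)
  case (conv N)
  then obtain C where C: "is_proof C" "concl C = (M, N)" "conversion_piece M N (cut C)"
    using conversion_piece_proof by blast
  let ?T = "Leibniz M (Var 0) M N (Identity M) C"
  have "chain M N (cut ?T)"
    using chain.start[OF conv(1) C(3)] by (simp add: transitivity_def)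
  moreover have "is_proof ?T" using C conv by auto
  ultimately show ?case using conv by (intro exI[of _ ?T]) auto
next
  case (step K P Q N)
  then obtain E where E: "is_proof E" "concl E = (M, App K P)" "chain M (App K P) (cut E)"
    by blast
  obtain F where F: "is_proof (Omega_Rule P Q F)" using step.hyps by (auto simp: omega_eq_def)
  have M: "closed_trm M" using step.hyps(1) chain_eq_closed by blast
  have KQ: "closed_trm (App K Q)" using step.hyps omega_eq_closed by auto
  then obtain C where C: "is_proof C" "concl C = (App K Q, N)"
      "conversion_piece (App K Q) N (cut C)"
    using conversion_piece_proof step.hyps by blast
  \<comment> \<open>\<open>?E\<close> performs the replacement of \<open>P\<close> by
    \<open>Q\<close> and \<open>?T\<close> the transitivity step to \<open>N\<close>; both keep the
    closed \<open>M\<close> as left context.\<close>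
  let ?E = "Leibniz M (App K (Var 0)) P Q E (Omega_Rule P Q F)"
  let ?T = "Leibniz M (Var 0) (App K Q) N ?E C"
  have "chain M N (cut ?T)"
    using chain.step[OF E(3) step.hyps(2) C(3)] by (simp add: transitivity_def replacement_def)
  moreover have "is_proof ?T"
    using E F C M step.hyps(2) by auto
  ultimately show ?case using M by (intro exI[of _ ?T]) auto
qed

theorem theorem5p2:
  fixes T :: tree
  assumes "is_proof T"
  shows "\<exists>T'. is_proof T' \<and> concl T' = concl T \<and>
           (endpiece_of T \<noteq> None \<longrightarrow> endpiece_of T' \<noteq> None) \<and>
           (\<forall>E. endpiece_of T' = Some E \<longrightarrow> normal_form E)"
proof -
  obtain M N where MN: "concl T = (M, N)" by fastforce
  obtain T' where T': "is_proof T'" "concl T' = (M, N)" "chain M N (cut T')"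
    using proof_imp_chain_eq[OF assms MN] chain_eq_imp_chain by blast
  \<comment> \<open>A chain has a Leibniz node at its root, whereas an omega-rule inference is cut
    to an \<open>Omega_Leaf\<close>. Thus \<open>T'\<close> always has an endpiece.\<close>
  have "\<not> ends_with_omega T'"
    using T'(3) by (cases T') (auto elim: chain.cases simp: transitivity_def)
  then show ?thesis
    using T' MN by (intro exI[of _ T']) (auto simp: endpiece_of_def intro: normal_form.intros)
qed

end
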